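(* The rule $G\mapsto K_G$ defines a functor $\Phi\colon \mathbf{Grp}^{\mathrm{op}}\to \mathbf{Comonads}(\mathbf{Set})$. More precisely, for a group morphism $f\colon G\to H$, the induced comonad morphism $\Phi(f)\colon K_H\Rightarrow K_G$ has components $\Phi(f)_X(\alpha)=\alpha\circ f$ for every set $X$ and every $\alpha\in K_H(X)=X^H$.
   Context: For a group $G$, the comonad $K_G=(K_G,\epsilon^G,\delta^G)$ on $\mathbf{Set}$ is given by: $K_G(X)=X^G$, the set of all functions $G\to X$; $K_G(f)(\phi)=f\circ\phi$ for a map $f\colon X\to Y$; counit $\epsilon^G_X\colon X^G\to X$, $\epsilon^G_X(\phi)=\phi(e_G)$; comultiplication $\delta^G_X\colon X^G\to (X^G)^G$, $\delta^G_X(\phi)(g)(h)=\phi(gh)$. A morphism of comonads $(K,\epsilon,\delta)\to(K',\epsilon',\delta')$ on a category is a natural transformation $\phi\colon K\Rightarrow K'$ with $\epsilon'\circ\phi=\epsilon$ and $\delta'\circ\phi=(\phi\phi)\circ\delta$, where $\phi\phi\colon K^2\Rightarrow K'^2$ is the horizontal composite. $\mathbf{Comonads}(\mathbf{Set})$ is the category of comonads on $\mathbf{Set}$ and morphisms of comonads. *)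

theory Defs
  imports "HOL-Algebra.Group" "HOL-Library.Nat_Bijection"
begin

text \<open>
  Arrows carry no source and target, so hom-sets are indexed by pairs of objects and may overlap;
  composition receives the three objects involved:
  \<open>Comp C a b c g f\<close> is \<open>g \<circ> f\<close> for \<open>f : a \<rightarrow> b\<close> and \<open>g : b \<rightarrow> c\<close>.
\<close>

record ('o, 'm) cat =
  Obj :: "'o set"
  Hom :: "'o \<Rightarrow> 'o \<Rightarrow> 'm set"
  Ident :: "'o \<Rightarrow> 'm"
  Comp :: "'o \<Rightarrow> 'o \<Rightarrow> 'o \<Rightarrow> 'm \<Rightarrow> 'm \<Rightarrow> 'm"

locale category =
  fixes C :: "('o, 'm) cat"
  assumes Hom_Obj: "f \<in> Hom C a b \<Longrightarrow> a \<in> Obj C \<and> b \<in> Obj C"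
    and Ident_in_Hom: "a \<in> Obj C \<Longrightarrow> Ident C a \<in> Hom C a a"
    and Comp_in_Hom: "f \<in> Hom C a b \<Longrightarrow> g \<in> Hom C b c \<Longrightarrow> Comp C a b c g f \<in> Hom C a c"
    and Comp_Ident_left: "f \<in> Hom C a b \<Longrightarrow> Comp C a b b (Ident C b) f = f"
    and Comp_Ident_right: "f \<in> Hom C a b \<Longrightarrow> Comp C a a b f (Ident C a) = f"
    and Comp_assoc: "f \<in> Hom C a b \<Longrightarrow> g \<in> Hom C b c \<Longrightarrow> h \<in> Hom C c d \<Longrightarrow>
      Comp C a b d (Comp C b c d h g) f = Comp C a c d h (Comp C a b c g f)"

definition op_cat :: "('o, 'm) cat \<Rightarrow> ('o, 'm) cat" where
  "op_cat C = \<lparr>Obj = Obj C, Hom = (\<lambda>a b. Hom C b a), Ident = Ident C,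
     Comp = (\<lambda>a b c g f. Comp C c b a f g)\<rparr>"

record ('o1, 'm1, 'o2, 'm2) fctr =
  FObj :: "'o1 \<Rightarrow> 'o2"
  FMor :: "'o1 \<Rightarrow> 'o1 \<Rightarrow> 'm1 \<Rightarrow> 'm2"

text \<open>
  The extensional function spaces make a functor determined by its values on the objects and arrows
  of its source, so that equality of functors is equality of HOL terms.
\<close>

locale is_functor = src: category C + tgt: category D
  for C :: "('o1, 'm1) cat" and D :: "('o2, 'm2) cat" and F :: "('o1, 'm1, 'o2, 'm2) fctr" +
  assumes FObj_in: "FObj F \<in> Obj C \<rightarrow>\<^sub>E Obj D"
    and FMor_in: "FMor F a b \<in> Hom C a b \<rightarrow>\<^sub>E Hom D (FObj F a) (FObj F b)"
    and FMor_Ident: "a \<in> Obj C \<Longrightarrow> FMor F a a (Ident C a) = Ident D (FObj F a)"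
    and FMor_Comp: "f \<in> Hom C a b \<Longrightarrow> g \<in> Hom C b c \<Longrightarrow>
      FMor F a c (Comp C a b c g f)
        = Comp D (FObj F a) (FObj F b) (FObj F c) (FMor F b c g) (FMor F a b f)"

definition mk_functor ::
  "('o1, 'm1) cat \<Rightarrow> ('o1 \<Rightarrow> 'o2) \<Rightarrow> ('o1 \<Rightarrow> 'o1 \<Rightarrow> 'm1 \<Rightarrow> 'm2) \<Rightarrow> ('o1, 'm1, 'o2, 'm2) fctr" where
  "mk_functor C Fo Fm =
     \<lparr>FObj = restrict Fo (Obj C), FMor = (\<lambda>a b. restrict (Fm a b) (Hom C a b))\<rparr>"

definition id_functor :: "('o, 'm) cat \<Rightarrow> ('o, 'm, 'o, 'm) fctr" where
  "id_functor C = mk_functor C (\<lambda>a. a) (\<lambda>a b f. f)"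

definition comp_functor ::
  "('o1, 'm1) cat \<Rightarrow> ('o2, 'm2, 'o3, 'm3) fctr \<Rightarrow> ('o1, 'm1, 'o2, 'm2) fctr
     \<Rightarrow> ('o1, 'm1, 'o3, 'm3) fctr" where
  "comp_functor C G F = mk_functor C (\<lambda>a. FObj G (FObj F a))
     (\<lambda>a b f. FMor G (FObj F a) (FObj F b) (FMor F a b f))"

definition nat_trans ::
  "('o1, 'm1) cat \<Rightarrow> ('o2, 'm2) cat \<Rightarrow> ('o1, 'm1, 'o2, 'm2) fctr \<Rightarrow> ('o1, 'm1, 'o2, 'm2) fctr
     \<Rightarrow> ('o1 \<Rightarrow> 'm2) set" where
  "nat_trans C D F G =
     {\<tau> \<in> (\<Pi>\<^sub>E a\<in>Obj C. Hom D (FObj F a) (FObj G a)).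
        \<forall>a b. \<forall>f\<in>Hom C a b.
          Comp D (FObj F a) (FObj F b) (FObj G b) (\<tau> b) (FMor F a b f)
            = Comp D (FObj F a) (FObj G a) (FObj G b) (FMor G a b f) (\<tau> a)}"

definition id_trans ::
  "('o1, 'm1) cat \<Rightarrow> ('o2, 'm2) cat \<Rightarrow> ('o1, 'm1, 'o2, 'm2) fctr \<Rightarrow> 'o1 \<Rightarrow> 'm2" where
  "id_trans C D F = (\<lambda>a\<in>Obj C. Ident D (FObj F a))"

text \<open>Vertical composite \<open>\<tau> \<circ> \<sigma>\<close> of \<open>\<sigma> : F \<Rightarrow> G\<close> and \<open>\<tau> : G \<Rightarrow> H\<close>.\<close>

definition vcomp ::
  "('o1, 'm1) cat \<Rightarrow> ('o2, 'm2) cat \<Rightarrow> ('o1, 'm1, 'o2, 'm2) fctr \<Rightarrow> ('o1, 'm1, 'o2, 'm2) fctr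
     \<Rightarrow> ('o1, 'm1, 'o2, 'm2) fctr \<Rightarrow> ('o1 \<Rightarrow> 'm2) \<Rightarrow> ('o1 \<Rightarrow> 'm2) \<Rightarrow> 'o1 \<Rightarrow> 'm2" where
  "vcomp C D F G H \<tau> \<sigma> = (\<lambda>a\<in>Obj C. Comp D (FObj F a) (FObj G a) (FObj H a) (\<tau> a) (\<sigma> a))"

text \<open>
  Horizontal composite \<open>H \<circ> F \<Rightarrow> H' \<circ> F'\<close> of \<open>\<sigma> : F \<Rightarrow> F'\<close> (between functors from \<open>C\<close> to \<open>D\<close>) and
  \<open>\<tau> : H \<Rightarrow> H'\<close> (between functors from \<open>D\<close> to \<open>E\<close>).
\<close>

definition hcomp ::
  "('o1, 'm1) cat \<Rightarrow> ('o3, 'm3) cat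
     \<Rightarrow> ('o1, 'm1, 'o2, 'm2) fctr \<Rightarrow> ('o1, 'm1, 'o2, 'm2) fctr
     \<Rightarrow> ('o2, 'm2, 'o3, 'm3) fctr \<Rightarrow> ('o2, 'm2, 'o3, 'm3) fctr
     \<Rightarrow> ('o2 \<Rightarrow> 'm3) \<Rightarrow> ('o1 \<Rightarrow> 'm2) \<Rightarrow> 'o1 \<Rightarrow> 'm3" where
  "hcomp C E F F' H H' \<tau> \<sigma> = (\<lambda>a\<in>Obj C.
     Comp E (FObj H (FObj F a)) (FObj H (FObj F' a)) (FObj H' (FObj F' a))
       (\<tau> (FObj F' a)) (FMor H (FObj F a) (FObj F' a) (\<sigma> a)))"

record ('o, 'm) cmnd =
  Fun :: "('o, 'm, 'o, 'm) fctr"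
  Counit :: "'o \<Rightarrow> 'm"
  Comult :: "'o \<Rightarrow> 'm"

locale comonad = is_functor C C "Fun K"
  for C :: "('o, 'm) cat" and K :: "('o, 'm) cmnd" +
  assumes Counit_nat: "Counit K \<in> nat_trans C C (Fun K) (id_functor C)"
    and Comult_nat: "Comult K \<in> nat_trans C C (Fun K) (comp_functor C (Fun K) (Fun K))"
    and counit_left: "X \<in> Obj C \<Longrightarrow>
      Comp C (FObj (Fun K) X) (FObj (Fun K) (FObj (Fun K) X)) (FObj (Fun K) X)
        (Counit K (FObj (Fun K) X)) (Comult K X) = Ident C (FObj (Fun K) X)"
    and counit_right: "X \<in> Obj C \<Longrightarrow>
      Comp C (FObj (Fun K) X) (FObj (Fun K) (FObj (Fun K) X)) (FObj (Fun K) X)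
        (FMor (Fun K) (FObj (Fun K) X) X (Counit K X)) (Comult K X) = Ident C (FObj (Fun K) X)"
    and coassoc: "X \<in> Obj C \<Longrightarrow>
      Comp C (FObj (Fun K) X) (FObj (Fun K) (FObj (Fun K) X))
          (FObj (Fun K) (FObj (Fun K) (FObj (Fun K) X)))
        (Comult K (FObj (Fun K) X)) (Comult K X)
      = Comp C (FObj (Fun K) X) (FObj (Fun K) (FObj (Fun K) X))
          (FObj (Fun K) (FObj (Fun K) (FObj (Fun K) X)))
        (FMor (Fun K) (FObj (Fun K) X) (FObj (Fun K) (FObj (Fun K) X)) (Comult K X)) (Comult K X)"

definition comonad_morphisms ::
  "('o, 'm) cat \<Rightarrow> ('o, 'm) cmnd \<Rightarrow> ('o, 'm) cmnd \<Rightarrow> ('o \<Rightarrow> 'm) set" where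
  "comonad_morphisms C K K' =
     {\<phi> \<in> nat_trans C C (Fun K) (Fun K').
        comonad C K \<and> comonad C K' \<and>
        vcomp C C (Fun K) (Fun K') (id_functor C) (Counit K') \<phi> = Counit K \<and>
        vcomp C C (Fun K) (Fun K') (comp_functor C (Fun K') (Fun K')) (Comult K') \<phi>
          = vcomp C C (Fun K) (comp_functor C (Fun K) (Fun K)) (comp_functor C (Fun K') (Fun K'))
              (hcomp C C (Fun K) (Fun K') (Fun K) (Fun K') \<phi> \<phi>) (Comult K)}"

definition Comonads :: "('o, 'm) cat \<Rightarrow> (('o, 'm) cmnd, 'o \<Rightarrow> 'm) cat" where
  "Comonads C = \<lparr>Obj = {K. comonad C K}, Hom = comonad_morphisms C,
     Ident = (\<lambda>K. id_trans C C (Fun K)),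
     Comp = (\<lambda>K L M. vcomp C C (Fun K) (Fun L) (Fun M))\<rparr>"

text \<open>
  A type of class \<open>universe\<close> is a universe in the sense of Grothendieck: its elements are sets,
  \<open>elts x\<close> is the collection of members of \<open>x\<close>, and the \<^emph>\<open>small\<close> collections (those of the form
  \<open>elts x\<close>) are closed under subcollections, replacement, unions and powersets.  Neither infinity nor
  foundation is required, so that statements about this class hold for every Grothendieck universe.
\<close>

class universe =
  fixes elts :: "'a \<Rightarrow> 'a set"
  assumes elts_inject: "elts x = elts y \<Longrightarrow> x = y"
    and subset_range_elts: "Y \<subseteq> elts x \<Longrightarrow> Y \<in> range elts"
    and image_range_elts: "f ` elts x \<in> range elts"
    and Union_range_elts: "\<Union> (elts ` elts x) \<in> range elts"
    and Pow_range_elts: "{y. elts y \<subseteq> elts x} \<in> range elts"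

text \<open>The class is inhabited: Ackermann's encoding gives the hereditarily finite sets.\<close>

instantiation nat :: universe
begin

definition elts_nat :: "nat \<Rightarrow> nat set" where
  "elts_nat = set_decode"

instance
proof
  have ran: "Y \<in> range (elts :: nat \<Rightarrow> nat set)" if "finite Y" for Y :: "nat set"
    using rangeI[of set_decode "set_encode Y"] by (simp add: that elts_nat_def)
  have fin: "finite (elts (x::nat))" for x
    by (simp add: elts_nat_def)
  show inj: "x = y" if "elts x = elts y" for x y :: nat
    using arg_cong[OF that, of set_encode] by (simp add: elts_nat_def)
  show "Y \<in> range elts" if "Y \<subseteq> elts x" for Y and x :: nat
    using that fin finite_subset ran by blast
  show "f ` elts x \<in> range elts" for f :: "nat \<Rightarrow> nat" and x
    by (simp add: fin ran)
  show "\<Union> (elts ` elts x) \<in> range elts" for x :: nat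
    by (simp add: fin ran)
  show "{y. elts y \<subseteq> elts x} \<in> range elts" for x :: nat
  proof (rule ran)
    have "finite (elts ` {y. elts y \<subseteq> elts x})"
      by (rule finite_subset[of _ "Pow (elts x)"]) (auto simp: fin)
    then show "finite {y. elts y \<subseteq> elts x}"
      by (rule finite_imageD) (auto simp: inj_on_def intro: inj)
  qed
qed

end

definition small :: "'u::universe set \<Rightarrow> bool" where
  "small A \<longleftrightarrow> A \<in> range elts"

definition vset :: "'u::universe set \<Rightarrow> 'u" where
  "vset A = (THE x. elts x = A)"

definition vpair :: "'u::universe \<Rightarrow> 'u \<Rightarrow> 'u" where
  "vpair a b = vset {vset {a}, vset {a, b}}"

text \<open>
  The elements of \<open>X\<^sup>A\<close> must themselves be elements of the universe, so functions from \<open>A\<close> to \<open>X\<close>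
  are represented there by their graphs; \<open>expo A X\<close> is the set \<open>X\<^sup>A\<close>.
\<close>

definition graph :: "'u::universe set \<Rightarrow> ('u \<Rightarrow> 'u) \<Rightarrow> 'u" where
  "graph A f = vset ((\<lambda>a. vpair a (f a)) ` A)"

definition app :: "'u::universe \<Rightarrow> 'u \<Rightarrow> 'u" where
  "app \<phi> a = (THE b. vpair a b \<in> elts \<phi>)"

definition expo :: "'u::universe set \<Rightarrow> 'u set \<Rightarrow> 'u set" where
  "expo A X = graph A ` (A \<rightarrow>\<^sub>E X)"

lemma elts_vset: "small A \<Longrightarrow> elts (vset A) = A"
proof -
  assume "small A"
  then obtain x where x: "A = elts x"
    unfolding small_def by blast
  have "vset A = x"
    unfolding vset_def x by (rule the_equality) (rule refl, erule elts_inject)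
  then show ?thesis
    by (simp add: x)
qed

lemma small_elts: "small (elts x)"
  by (simp add: small_def)

lemma small_subset: "small A \<Longrightarrow> B \<subseteq> A \<Longrightarrow> small B"
  unfolding small_def by (erule rangeE) (simp only: subset_range_elts)

lemma small_image: "small A \<Longrightarrow> small (f ` A)" for f :: "'u::universe \<Rightarrow> 'u"
  unfolding small_def by (erule rangeE) (simp only: image_range_elts)

lemma small_UN: "small A \<Longrightarrow> (\<And>a. a \<in> A \<Longrightarrow> small (B a)) \<Longrightarrow> small (\<Union>a\<in>A. B a)"
  for B :: "'u::universe \<Rightarrow> 'u set"
proof -
  assume A: "small A" and B: "\<And>a. a \<in> A \<Longrightarrow> small (B a)"
  have "small ((\<lambda>a. vset (B a)) ` A)"
    using A by (rule small_image)
  then obtain y where y: "(\<lambda>a. vset (B a)) ` A = elts y"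
    unfolding small_def by blast
  have "(\<Union>a\<in>A. B a) = \<Union> (elts ` ((\<lambda>a. vset (B a)) ` A))"
    unfolding image_image using B by (simp add: elts_vset)
  then show ?thesis
    by (simp only: y small_def Union_range_elts)
qed

lemma small_Pow: "small A \<Longrightarrow> small (vset ` Pow A)" for A :: "'u::universe set"
proof -
  assume A: "small A"
  then obtain x where x: "A = elts x"
    unfolding small_def by blast
  have "vset ` Pow A \<subseteq> {y. elts y \<subseteq> elts x}"
    using A by (auto simp: x elts_vset[OF small_subset[OF small_elts]])
  then show ?thesis
    using Pow_range_elts[of x] small_subset small_def by blast
qed

lemma small_empty: "small ({} :: 'u::universe set)"
  using small_elts small_subset by blast

lemma small_doubleton: "small {a, b :: 'u::universe}"
proof -
  let ?e = "vset {} :: 'u" and ?s = "vset {vset {}} :: 'u"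
  have s: "elts ?s = {?e}"
    using small_Pow[OF small_empty[where 'u = 'u]] by (simp add: elts_vset)
  then have "?e \<noteq> ?s"
    using elts_vset[OF small_empty] by (metis empty_not_insert)
  moreover have "small (vset ` Pow {?e})"
    using small_elts[of ?s] unfolding s by (rule small_Pow)
  then have "small {?e, ?s}"
    by (rule small_subset) simp
  then have "small ((\<lambda>x. if x = ?e then a else b) ` {?e, ?s})"
    by (rule small_image)
  ultimately show ?thesis
    by (simp add: insert_commute)
qed

lemma small_singleton: "small {a}"
  using small_doubleton[of a a] by simp

lemma vset_inject: "small A \<Longrightarrow> small B \<Longrightarrow> vset A = vset B \<longleftrightarrow> A = B"
  by (metis elts_vset)

lemma vpair_inject: "vpair a b = vpair c d \<longleftrightarrow> a = c \<and> b = d"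
  by (auto simp: vpair_def vset_inject small_doubleton small_singleton doubleton_eq_iff)

lemma elts_graph: "small A \<Longrightarrow> elts (graph A f) = (\<lambda>a. vpair a (f a)) ` A"
  by (simp add: graph_def elts_vset small_image)

lemma app_graph: "small A \<Longrightarrow> a \<in> A \<Longrightarrow> app (graph A f) a = f a"
  by (auto simp: app_def elts_graph vpair_inject)

lemma graph_inject: "small A \<Longrightarrow> graph A f = graph A g \<longleftrightarrow> (\<forall>a\<in>A. f a = g a)"
proof
  assume A: "small A" and eq: "graph A f = graph A g"
  show "\<forall>a\<in>A. f a = g a"
    using app_graph[OF A, of _ f] app_graph[OF A, of _ g] by (simp add: eq)
next
  assume "\<forall>a\<in>A. f a = g a"
  then show "graph A f = graph A g"
    by (simp add: graph_def)
qed

lemma small_expo: "small A \<Longrightarrow> small X \<Longrightarrow> small (expo A X)"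
proof -
  assume A: "small A" and X: "small X"
  have "small (\<Union>a\<in>A. vpair a ` X)"
    by (intro small_UN small_image A X)
  then have "small (vset ` Pow (\<Union>a\<in>A. vpair a ` X))"
    by (rule small_Pow)
  then show ?thesis
    by (rule small_subset) (auto simp: expo_def graph_def intro!: imageI)
qed

text \<open>
  Objects of \<open>Sets\<close> are the small sets, objects of \<open>Grp\<close> the groups with small carrier; arrows are
  extensional, so that they are determined by their values on the source.
\<close>

definition Sets :: "('u::universe set, 'u \<Rightarrow> 'u) cat" where
  "Sets = \<lparr>Obj = {X. small X},
     Hom = (\<lambda>X Y. if small X \<and> small Y then X \<rightarrow>\<^sub>E Y else {}),
     Ident = (\<lambda>X. \<lambda>x\<in>X. x),
     Comp = (\<lambda>X Y Z g f. compose X g f)\<rparr>"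

definition Grp :: "('u::universe monoid, 'u \<Rightarrow> 'u) cat" where
  "Grp = \<lparr>Obj = {G. group G \<and> small (carrier G)},
     Hom = (\<lambda>G H. if group G \<and> small (carrier G) \<and> group H \<and> small (carrier H)
                   then hom G H \<inter> extensional (carrier G) else {}),
     Ident = (\<lambda>G. \<lambda>x\<in>carrier G. x),
     Comp = (\<lambda>G H J g f. compose (carrier G) g f)\<rparr>"

definition K_functor ::
  "'u::universe monoid \<Rightarrow> ('u set, 'u \<Rightarrow> 'u, 'u set, 'u \<Rightarrow> 'u) fctr" where
  "K_functor G = mk_functor Sets (\<lambda>X. expo (carrier G) X)
     (\<lambda>X Y f. \<lambda>\<phi>\<in>expo (carrier G) X. graph (carrier G) (\<lambda>g. f (app \<phi> g)))"

definition K_comonad :: "'u::universe monoid \<Rightarrow> ('u set, 'u \<Rightarrow> 'u) cmnd" where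
  "K_comonad G = \<lparr>Fun = K_functor G,
     Counit = (\<lambda>X\<in>Obj Sets. \<lambda>\<phi>\<in>expo (carrier G) X. app \<phi> \<one>\<^bsub>G\<^esub>),
     Comult = (\<lambda>X\<in>Obj Sets. \<lambda>\<phi>\<in>expo (carrier G) X.
       graph (carrier G) (\<lambda>g. graph (carrier G) (\<lambda>h. app \<phi> (g \<otimes>\<^bsub>G\<^esub> h))))\<rparr>"

text \<open>
  An arrow \<open>f\<close> from \<open>H\<close> to \<open>G\<close> in the opposite of \<open>Grp\<close> is a group morphism from \<open>G\<close> to \<open>H\<close>.
\<close>

definition Phi :: "('u::universe monoid, 'u \<Rightarrow> 'u,
    ('u set, 'u \<Rightarrow> 'u) cmnd, 'u set \<Rightarrow> 'u \<Rightarrow> 'u) fctr" where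
  "Phi = mk_functor (op_cat Grp) K_comonad
     (\<lambda>H G f. \<lambda>X\<in>Obj Sets. \<lambda>\<alpha>\<in>expo (carrier H) X. graph (carrier G) (\<lambda>g. app \<alpha> (f g)))"

end

theory Submission
  imports Defs
begin

text \<open>
  A morphism \<open>f : G \<rightarrow> H\<close> acts by precomposition, which commutes with postcomposition (naturality),
  with evaluation at the unit since \<open>f e = e\<close>, and with the comultiplication since
  \<open>f (g h) = f g f h\<close>.  That comonad morphisms compose is a diagram chase over an arbitrary category;
  the one step that is not an axiom of comonad morphisms is the naturality of the first of them at the
  components of the second.
\<close>

section \<open>Functors and comonads over an arbitrary category\<close>

text \<open>The axioms are self-dual: reversing arrows exchanges the two unit laws and reads
  associativity backwards.\<close>

lemma category_op_cat: "category C \<Longrightarrow> category (op_cat C)"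
  unfolding category_def op_cat_def by simp

lemma FObj_mk_functor: "a \<in> Obj C \<Longrightarrow> FObj (mk_functor C Fo Fm) a = Fo a"
  by (simp add: mk_functor_def)

lemma FMor_mk_functor: "f \<in> Hom C a b \<Longrightarrow> FMor (mk_functor C Fo Fm) a b f = Fm a b f"
  by (simp add: mk_functor_def)

text \<open>Lets the functor laws be checked on the raw maps \<open>Fo\<close> and
  \<open>Fm\<close>. The restrictions disappear because the axioms of \<open>C\<close> keep
  identities and composites in the hom-sets on which \<open>mk_functor\<close> is defined. Serves
  for both \<open>K_functor\<close> and \<open>Phi\<close>.\<close>

lemma is_functor_mk_functor:
  assumes "category C" "category D"
    and "\<And>a. a \<in> Obj C \<Longrightarrow> Fo a \<in> Obj D"
    and "\<And>a b f. f \<in> Hom C a b \<Longrightarrow> Fm a b f \<in> Hom D (Fo a) (Fo b)"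
    and "\<And>a. a \<in> Obj C \<Longrightarrow> Fm a a (Ident C a) = Ident D (Fo a)"
    and "\<And>a b c f g. f \<in> Hom C a b \<Longrightarrow> g \<in> Hom C b c \<Longrightarrow>
      Fm a c (Comp C a b c g f) = Comp D (Fo a) (Fo b) (Fo c) (Fm b c g) (Fm a b f)"
  shows "is_functor C D (mk_functor C Fo Fm)"
proof -
  interpret C: category C by fact
  interpret D: category D by fact
  show ?thesis
  proof
    show "FMor (mk_functor C Fo Fm) a b \<in> Hom C a b \<rightarrow>\<^sub>E
        Hom D (FObj (mk_functor C Fo Fm) a) (FObj (mk_functor C Fo Fm) b)" for a b
      using assms(4) C.Hom_Obj by (fastforce simp: mk_functor_def)
    show "FMor (mk_functor C Fo Fm) a c (Comp C a b c g f)
        = Comp D (FObj (mk_functor C Fo Fm) a) (FObj (mk_functor C Fo Fm) b)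
            (FObj (mk_functor C Fo Fm) c) (FMor (mk_functor C Fo Fm) b c g)
            (FMor (mk_functor C Fo Fm) a b f)"
      if "f \<in> Hom C a b" "g \<in> Hom C b c" for f g a b c
      using that assms(6) C.Hom_Obj C.Comp_in_Hom by (simp add: mk_functor_def)
  qed (use assms C.Ident_in_Hom in \<open>auto simp: mk_functor_def\<close>)
qed

context is_functor
begin

lemma FObj_Obj: "a \<in> Obj C \<Longrightarrow> FObj F a \<in> Obj D"
  using FObj_in by auto

lemma FMor_Hom: "f \<in> Hom C a b \<Longrightarrow> FMor F a b f \<in> Hom D (FObj F a) (FObj F b)"
  using FMor_in by auto

end

section \<open>Natural transformations, their identities and vertical composites\<close>

lemma nat_transI:
  assumes "\<And>a. a \<in> Obj C \<Longrightarrow> \<tau> a \<in> Hom D (FObj F a) (FObj G a)"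
    and "\<tau> \<in> extensional (Obj C)"
    and "\<And>a b f. f \<in> Hom C a b \<Longrightarrow>
      Comp D (FObj F a) (FObj F b) (FObj G b) (\<tau> b) (FMor F a b f)
        = Comp D (FObj F a) (FObj G a) (FObj G b) (FMor G a b f) (\<tau> a)"
  shows "\<tau> \<in> nat_trans C D F G"
  using assms by (auto simp: nat_trans_def PiE_iff)

lemma nat_trans_Hom:
  "\<tau> \<in> nat_trans C D F G \<Longrightarrow> a \<in> Obj C \<Longrightarrow> \<tau> a \<in> Hom D (FObj F a) (FObj G a)"
  by (auto simp: nat_trans_def)

lemma nat_trans_extensional: "\<tau> \<in> nat_trans C D F G \<Longrightarrow> \<tau> \<in> extensional (Obj C)"
  by (auto simp: nat_trans_def PiE_iff)

lemma nat_trans_natural: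
  "\<tau> \<in> nat_trans C D F G \<Longrightarrow> f \<in> Hom C a b \<Longrightarrow>
    Comp D (FObj F a) (FObj F b) (FObj G b) (\<tau> b) (FMor F a b f)
      = Comp D (FObj F a) (FObj G a) (FObj G b) (FMor G a b f) (\<tau> a)"
  by (auto simp: nat_trans_def)

lemma id_trans_nat_trans:
  assumes "is_functor C D F"
  shows "id_trans C D F \<in> nat_trans C D F F"
proof -
  interpret F: is_functor C D F by fact
  show ?thesis
  proof (rule nat_transI)
    fix a b f assume f: "f \<in> Hom C a b"
    then show "Comp D (FObj F a) (FObj F b) (FObj F b) (id_trans C D F b) (FMor F a b f)
        = Comp D (FObj F a) (FObj F a) (FObj F b) (FMor F a b f) (id_trans C D F a)"
      using F.src.Hom_Obj[OF f] F.FMor_Hom[OF f]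
      by (simp add: id_trans_def F.tgt.Comp_Ident_left F.tgt.Comp_Ident_right)
  qed (auto simp: id_trans_def F.FObj_Obj F.tgt.Ident_in_Hom)
qed

text \<open>The naturality squares of \<open>\<sigma>\<close> and \<open>\<tau>\<close> at
  \<open>f\<close> are pasted along their common edge \<open>G f\<close>; each gives one rewriting
  step, and the other steps reassociate.\<close>

lemma vcomp_nat_trans:
  assumes "is_functor C D F" "is_functor C D G" "is_functor C D H"
    and \<sigma>: "\<sigma> \<in> nat_trans C D F G" and \<tau>: "\<tau> \<in> nat_trans C D G H"
  shows "vcomp C D F G H \<tau> \<sigma> \<in> nat_trans C D F H"
proof -
  interpret F: is_functor C D F by fact
  interpret G: is_functor C D G by fact
  interpret H: is_functor C D H by fact
  show ?thesis
  proof (rule nat_transI)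
    show "vcomp C D F G H \<tau> \<sigma> a \<in> Hom D (FObj F a) (FObj H a)" if "a \<in> Obj C" for a
      using that nat_trans_Hom[OF \<sigma> that] nat_trans_Hom[OF \<tau> that]
      by (simp add: vcomp_def F.tgt.Comp_in_Hom)
    show "vcomp C D F G H \<tau> \<sigma> \<in> extensional (Obj C)"
      by (simp add: vcomp_def)
    fix a b f assume f: "f \<in> Hom C a b"
    then have ab: "a \<in> Obj C" "b \<in> Obj C"
      using F.src.Hom_Obj by auto
    note [simp] = nat_trans_Hom[OF \<sigma> ab(1)] nat_trans_Hom[OF \<sigma> ab(2)]
      nat_trans_Hom[OF \<tau> ab(1)] nat_trans_Hom[OF \<tau> ab(2)]
      F.FMor_Hom[OF f] G.FMor_Hom[OF f] H.FMor_Hom[OF f]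
    have "Comp D (FObj F a) (FObj F b) (FObj H b)
        (Comp D (FObj F b) (FObj G b) (FObj H b) (\<tau> b) (\<sigma> b)) (FMor F a b f)
      = Comp D (FObj F a) (FObj G b) (FObj H b) (\<tau> b)
          (Comp D (FObj F a) (FObj F b) (FObj G b) (\<sigma> b) (FMor F a b f))"
      by (rule F.tgt.Comp_assoc) simp_all
    also have "\<dots> = Comp D (FObj F a) (FObj G b) (FObj H b) (\<tau> b)
          (Comp D (FObj F a) (FObj G a) (FObj G b) (FMor G a b f) (\<sigma> a))"
      by (simp only: nat_trans_natural[OF \<sigma> f])
    also have "\<dots> = Comp D (FObj F a) (FObj G a) (FObj H b)
          (Comp D (FObj G a) (FObj G b) (FObj H b) (\<tau> b) (FMor G a b f)) (\<sigma> a)"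
      by (rule F.tgt.Comp_assoc[symmetric]) simp_all
    also have "\<dots> = Comp D (FObj F a) (FObj G a) (FObj H b)
          (Comp D (FObj G a) (FObj H a) (FObj H b) (FMor H a b f) (\<tau> a)) (\<sigma> a)"
      by (simp only: nat_trans_natural[OF \<tau> f])
    also have "\<dots> = Comp D (FObj F a) (FObj H a) (FObj H b) (FMor H a b f)
          (Comp D (FObj F a) (FObj G a) (FObj H a) (\<tau> a) (\<sigma> a))"
      by (rule F.tgt.Comp_assoc) simp_all
    finally show "Comp D (FObj F a) (FObj F b) (FObj H b) (vcomp C D F G H \<tau> \<sigma> b) (FMor F a b f)
        = Comp D (FObj F a) (FObj H a) (FObj H b) (FMor H a b f) (vcomp C D F G H \<tau> \<sigma> a)"
      using ab by (simp add: vcomp_def)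
  qed
qed

section \<open>Comonad morphisms and the category they form\<close>

lemma restrict_eq_extensional_iff:
  "h \<in> extensional A \<Longrightarrow> restrict f A = h \<longleftrightarrow> (\<forall>a\<in>A. f a = h a)"
  by (auto simp: restrict_def extensional_def fun_eq_iff)

lemma restrict_eq_restrict_iff: "restrict f A = restrict g A \<longleftrightarrow> (\<forall>a\<in>A. f a = g a)"
  by (auto simp: restrict_def fun_eq_iff)

text \<open>Reads the two axioms componentwise, with \<open>vcomp\<close> and \<open>hcomp\<close>
  expanded, which is the form used in diagram chases. The counit equation can be tested on objects
  since \<open>Counit K\<close> is extensional; this comes from \<open>K\<close> being a comonad,
  hence the case split.\<close>

lemma comonad_morphisms_iff:
  "\<phi> \<in> comonad_morphisms C K L \<longleftrightarrow>
    comonad C K \<and> comonad C L \<and> \<phi> \<in> nat_trans C C (Fun K) (Fun L) \<and>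
    (\<forall>a\<in>Obj C. Comp C (FObj (Fun K) a) (FObj (Fun L) a) a (Counit L a) (\<phi> a) = Counit K a) \<and>
    (\<forall>a\<in>Obj C.
      Comp C (FObj (Fun K) a) (FObj (Fun L) a) (FObj (Fun L) (FObj (Fun L) a)) (Comult L a) (\<phi> a)
      = Comp C (FObj (Fun K) a) (FObj (Fun K) (FObj (Fun K) a)) (FObj (Fun L) (FObj (Fun L) a))
          (Comp C (FObj (Fun K) (FObj (Fun K) a)) (FObj (Fun K) (FObj (Fun L) a))
            (FObj (Fun L) (FObj (Fun L) a)) (\<phi> (FObj (Fun L) a))
            (FMor (Fun K) (FObj (Fun K) a) (FObj (Fun L) a) (\<phi> a)))
          (Comult K a))"
proof (cases "comonad C K")
  case True
  then have "Counit K \<in> extensional (Obj C)"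
    using nat_trans_extensional comonad.Counit_nat by blast
  then show ?thesis
    by (auto simp: comonad_morphisms_def vcomp_def hcomp_def restrict_eq_extensional_iff
        restrict_eq_restrict_iff FObj_mk_functor id_functor_def comp_functor_def)
qed (simp add: comonad_morphisms_def)

context comonad
begin

lemma Counit_Hom: "a \<in> Obj C \<Longrightarrow> Counit K a \<in> Hom C (FObj (Fun K) a) a"
  using nat_trans_Hom[OF Counit_nat] by (simp add: id_functor_def FObj_mk_functor)

lemma Comult_Hom:
  "a \<in> Obj C \<Longrightarrow> Comult K a \<in> Hom C (FObj (Fun K) a) (FObj (Fun K) (FObj (Fun K) a))"
  using nat_trans_Hom[OF Comult_nat] by (simp add: comp_functor_def FObj_mk_functor)

end

text \<open>The horizontal composite of the identity with itself has components built from
  \<open>K id = id\<close>, so both axioms reduce to unit laws in \<open>C\<close>.\<close>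

lemma id_trans_comonad_morphism:
  assumes "comonad C K"
  shows "id_trans C C (Fun K) \<in> comonad_morphisms C K K"
proof -
  interpret K: comonad C K by fact
  show ?thesis
    by (simp add: comonad_morphisms_iff assms id_trans_nat_trans K.is_functor_axioms)
      (simp add: id_trans_def K.FObj_Obj K.FMor_Ident
        K.src.Comp_Ident_left[OF K.src.Ident_in_Hom] K.src.Comp_Ident_left[OF K.Comult_Hom]
        K.src.Comp_Ident_right[OF K.Comult_Hom] K.src.Comp_Ident_right[OF K.Counit_Hom])
qed

lemma vcomp_comonad_morphism:
  assumes \<phi>: "\<phi> \<in> comonad_morphisms C K L" and \<psi>: "\<psi> \<in> comonad_morphisms C L M"
  shows "vcomp C C (Fun K) (Fun L) (Fun M) \<psi> \<phi> \<in> comonad_morphisms C K M"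
proof -
  interpret K: comonad C K using \<phi> by (simp add: comonad_morphisms_iff)
  interpret L: comonad C L using \<phi> by (simp add: comonad_morphisms_iff)
  interpret M: comonad C M using \<psi> by (simp add: comonad_morphisms_iff)
  let ?k = "FObj (Fun K)" and ?l = "FObj (Fun L)" and ?m = "FObj (Fun M)"
  have \<phi>_nat: "\<phi> \<in> nat_trans C C (Fun K) (Fun L)" and \<psi>_nat: "\<psi> \<in> nat_trans C C (Fun L) (Fun M)"
    using \<phi> \<psi> by (simp_all add: comonad_morphisms_iff)
  note \<phi>_Hom = nat_trans_Hom[OF \<phi>_nat] and \<psi>_Hom = nat_trans_Hom[OF \<psi>_nat]
  \<comment> \<open>After reassociation, \<open>\<psi>\<close> turns the counit of \<open>M\<close>
    into that of \<open>L\<close>, and \<open>\<phi>\<close> turns the latter into that of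
    \<open>K\<close>.\<close>
  have counit: "Comp C (?k a) (?m a) a (Counit M a) (Comp C (?k a) (?l a) (?m a) (\<psi> a) (\<phi> a))
      = Counit K a" if a: "a \<in> Obj C" for a
    using \<phi> \<psi> a
    by (simp add: comonad_morphisms_iff
        K.src.Comp_assoc[OF \<phi>_Hom[OF a] \<psi>_Hom[OF a] M.Counit_Hom[OF a], symmetric])
  have comult: "Comp C (?k a) (?m a) (?m (?m a)) (Comult M a)
        (Comp C (?k a) (?l a) (?m a) (\<psi> a) (\<phi> a))
      = Comp C (?k a) (?k (?k a)) (?m (?m a))
          (Comp C (?k (?k a)) (?k (?m a)) (?m (?m a))
            (Comp C (?k (?m a)) (?l (?m a)) (?m (?m a)) (\<psi> (?m a)) (\<phi> (?m a)))
            (FMor (Fun K) (?k a) (?m a) (Comp C (?k a) (?l a) (?m a) (\<psi> a) (\<phi> a))))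
          (Comult K a)"
    if a: "a \<in> Obj C" for a
  proof -
    \<comment> \<open>These typing facts discharge the premises of \<open>Comp_assoc\<close>
      throughout the chase.\<close>
    note h [simp] = a \<phi>_Hom \<psi>_Hom K.FMor_Hom L.FMor_Hom M.FMor_Hom K.Comult_Hom L.Comult_Hom
      M.Comult_Hom K.FObj_Obj L.FObj_Obj M.FObj_Obj K.src.Comp_in_Hom
    note assoc = K.src.Comp_assoc
    have "Comp C (?k a) (?m a) (?m (?m a)) (Comult M a)
        (Comp C (?k a) (?l a) (?m a) (\<psi> a) (\<phi> a))
      = Comp C (?k a) (?l a) (?m (?m a))
          (Comp C (?l a) (?m a) (?m (?m a)) (Comult M a) (\<psi> a)) (\<phi> a)"
      by (rule assoc[symmetric]) simp_all
    also have "\<dots> = Comp C (?k a) (?l a) (?m (?m a))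
          (Comp C (?l a) (?l (?l a)) (?m (?m a))
            (Comp C (?l (?l a)) (?l (?m a)) (?m (?m a)) (\<psi> (?m a))
              (FMor (Fun L) (?l a) (?m a) (\<psi> a))) (Comult L a)) (\<phi> a)"
      using \<psi> a by (simp add: comonad_morphisms_iff)
    also have "\<dots> = Comp C (?k a) (?l (?l a)) (?m (?m a))
          (Comp C (?l (?l a)) (?l (?m a)) (?m (?m a)) (\<psi> (?m a))
              (FMor (Fun L) (?l a) (?m a) (\<psi> a)))
          (Comp C (?k a) (?l a) (?l (?l a)) (Comult L a) (\<phi> a))"
      by (rule assoc) simp_all
    also have "\<dots> = Comp C (?k a) (?l (?l a)) (?m (?m a))
          (Comp C (?l (?l a)) (?l (?m a)) (?m (?m a)) (\<psi> (?m a))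
              (FMor (Fun L) (?l a) (?m a) (\<psi> a)))
          (Comp C (?k a) (?k (?k a)) (?l (?l a))
            (Comp C (?k (?k a)) (?k (?l a)) (?l (?l a)) (\<phi> (?l a))
              (FMor (Fun K) (?k a) (?l a) (\<phi> a))) (Comult K a))"
      using \<phi> a by (simp add: comonad_morphisms_iff)
    also have "\<dots> = Comp C (?k a) (?k (?k a)) (?m (?m a))
          (Comp C (?k (?k a)) (?l (?l a)) (?m (?m a))
            (Comp C (?l (?l a)) (?l (?m a)) (?m (?m a)) (\<psi> (?m a))
              (FMor (Fun L) (?l a) (?m a) (\<psi> a)))
            (Comp C (?k (?k a)) (?k (?l a)) (?l (?l a)) (\<phi> (?l a))
              (FMor (Fun K) (?k a) (?l a) (\<phi> a)))) (Comult K a)"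
      by (rule assoc[symmetric]) simp_all
    \<comment> \<open>The comultiplication axioms of \<open>\<psi>\<close> and \<open>\<phi>\<close>
      have been applied. What remains is the interchange law: \<open>\<psi>\<psi>\<close> after
      \<open>\<phi>\<phi>\<close> is the horizontal square of \<open>\<psi>\<close> after
      \<open>\<phi>\<close>. From here on each \<open>also\<close> rewrites a subterm of the
      expression reached.\<close>
    also have "Comp C (?k (?k a)) (?l (?l a)) (?m (?m a))
            (Comp C (?l (?l a)) (?l (?m a)) (?m (?m a)) (\<psi> (?m a))
              (FMor (Fun L) (?l a) (?m a) (\<psi> a)))
            (Comp C (?k (?k a)) (?k (?l a)) (?l (?l a)) (\<phi> (?l a))
              (FMor (Fun K) (?k a) (?l a) (\<phi> a)))
        = Comp C (?k (?k a)) (?l (?m a)) (?m (?m a)) (\<psi> (?m a))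
            (Comp C (?k (?k a)) (?l (?l a)) (?l (?m a)) (FMor (Fun L) (?l a) (?m a) (\<psi> a))
              (Comp C (?k (?k a)) (?k (?l a)) (?l (?l a)) (\<phi> (?l a))
                (FMor (Fun K) (?k a) (?l a) (\<phi> a))))"
      by (rule assoc) simp_all
    also have "Comp C (?k (?k a)) (?l (?l a)) (?l (?m a)) (FMor (Fun L) (?l a) (?m a) (\<psi> a))
              (Comp C (?k (?k a)) (?k (?l a)) (?l (?l a)) (\<phi> (?l a))
                (FMor (Fun K) (?k a) (?l a) (\<phi> a)))
        = Comp C (?k (?k a)) (?k (?l a)) (?l (?m a))
            (Comp C (?k (?l a)) (?l (?l a)) (?l (?m a)) (FMor (Fun L) (?l a) (?m a) (\<psi> a))
              (\<phi> (?l a))) (FMor (Fun K) (?k a) (?l a) (\<phi> a))"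
      by (rule assoc[symmetric]) simp_all
    \<comment> \<open>Naturality of \<open>\<phi>\<close> at the arrow \<open>\<psi> a\<close> from
      \<open>L a\<close> to \<open>M a\<close>: it brings the two images under \<open>K\<close> next
      to each other, where functoriality can merge them.\<close>
    also have "Comp C (?k (?l a)) (?l (?l a)) (?l (?m a)) (FMor (Fun L) (?l a) (?m a) (\<psi> a))
              (\<phi> (?l a))
        = Comp C (?k (?l a)) (?k (?m a)) (?l (?m a)) (\<phi> (?m a)) (FMor (Fun K) (?l a) (?m a) (\<psi> a))"
      by (rule nat_trans_natural[OF \<phi>_nat, symmetric]) simp
    also have "Comp C (?k (?k a)) (?k (?l a)) (?l (?m a))
          (Comp C (?k (?l a)) (?k (?m a)) (?l (?m a)) (\<phi> (?m a)) (FMor (Fun K) (?l a) (?m a) (\<psi> a)))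
          (FMor (Fun K) (?k a) (?l a) (\<phi> a))
        = Comp C (?k (?k a)) (?k (?m a)) (?l (?m a)) (\<phi> (?m a))
          (Comp C (?k (?k a)) (?k (?l a)) (?k (?m a)) (FMor (Fun K) (?l a) (?m a) (\<psi> a))
            (FMor (Fun K) (?k a) (?l a) (\<phi> a)))"
      by (rule assoc) simp_all
    also have "Comp C (?k (?k a)) (?k (?l a)) (?k (?m a)) (FMor (Fun K) (?l a) (?m a) (\<psi> a))
            (FMor (Fun K) (?k a) (?l a) (\<phi> a))
        = FMor (Fun K) (?k a) (?m a) (Comp C (?k a) (?l a) (?m a) (\<psi> a) (\<phi> a))"
      by (rule K.FMor_Comp[symmetric]) simp_all
    also have "Comp C (?k (?k a)) (?l (?m a)) (?m (?m a)) (\<psi> (?m a))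
          (Comp C (?k (?k a)) (?k (?m a)) (?l (?m a)) (\<phi> (?m a))
            (FMor (Fun K) (?k a) (?m a) (Comp C (?k a) (?l a) (?m a) (\<psi> a) (\<phi> a))))
        = Comp C (?k (?k a)) (?k (?m a)) (?m (?m a))
            (Comp C (?k (?m a)) (?l (?m a)) (?m (?m a)) (\<psi> (?m a)) (\<phi> (?m a)))
            (FMor (Fun K) (?k a) (?m a) (Comp C (?k a) (?l a) (?m a) (\<psi> a) (\<phi> a)))"
      by (rule assoc[symmetric]) (simp_all add: K.src.Comp_in_Hom[OF h(2,3)])
    finally show ?thesis .
  qed
  show ?thesis
    unfolding comonad_morphisms_iff
    using vcomp_nat_trans[OF K.is_functor_axioms L.is_functor_axioms M.is_functor_axioms \<phi>_nat \<psi>_nat]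
    by (simp add: K.comonad_axioms M.comonad_axioms)
      (simp add: vcomp_def counit comult M.FObj_Obj)
qed

text \<open>Unit laws and associativity hold componentwise in \<open>C\<close>; since
  transformations are extensional, this gives equality of terms. Closure under composition is the
  preceding chase.\<close>

lemma category_Comonads:
  assumes "category C"
  shows "category (Comonads C)"
proof -
  interpret category C by fact
  show ?thesis
  proof
    fix \<phi> K L assume \<phi>: "\<phi> \<in> Hom (Comonads C) K L"
    then have K: "comonad C K" and L: "comonad C L"
      and nat: "\<phi> \<in> nat_trans C C (Fun K) (Fun L)"
      by (simp_all add: Comonads_def comonad_morphisms_iff)
    show "K \<in> Obj (Comonads C) \<and> L \<in> Obj (Comonads C)"
      by (simp add: Comonads_def K L)
    show "Comp (Comonads C) K L L (Ident (Comonads C) L) \<phi> = \<phi>"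
      and "Comp (Comonads C) K K L \<phi> (Ident (Comonads C) K) = \<phi>"
      using nat_trans_Hom[OF nat] nat_trans_extensional[OF nat]
      by (simp_all add: Comonads_def vcomp_def id_trans_def restrict_eq_extensional_iff
          Comp_Ident_left Comp_Ident_right)
    fix \<psi> M assume \<psi>: "\<psi> \<in> Hom (Comonads C) L M"
    show "Comp (Comonads C) K L M \<psi> \<phi> \<in> Hom (Comonads C) K M"
      using \<phi> \<psi> by (simp add: Comonads_def vcomp_comonad_morphism)
    fix \<chi> N assume \<chi>: "\<chi> \<in> Hom (Comonads C) M N"
    have "\<psi> \<in> nat_trans C C (Fun L) (Fun M)" "\<chi> \<in> nat_trans C C (Fun M) (Fun N)"
      using \<psi> \<chi> by (simp_all add: Comonads_def comonad_morphisms_iff)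
    from nat_trans_Hom[OF nat] nat_trans_Hom[OF this(1)] nat_trans_Hom[OF this(2)]
    show "Comp (Comonads C) K L N (Comp (Comonads C) L M N \<chi> \<psi>) \<phi>
        = Comp (Comonads C) K M N \<chi> (Comp (Comonads C) K L M \<psi> \<phi>)"
      by (simp add: Comonads_def vcomp_def restrict_eq_restrict_iff Comp_assoc)
  qed (simp add: Comonads_def id_trans_comonad_morphism)
qed

section \<open>The categories of sets and groups\<close>

lemma Obj_Sets: "X \<in> Obj Sets \<longleftrightarrow> small X"
  by (simp add: Sets_def)

lemma Hom_Sets: "f \<in> Hom Sets X Y \<longleftrightarrow> small X \<and> small Y \<and> f \<in> X \<rightarrow>\<^sub>E Y"
  by (auto simp: Sets_def)

lemma Ident_Sets: "Ident Sets X = (\<lambda>x\<in>X. x)"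
  by (simp add: Sets_def)

lemma Comp_Sets: "Comp Sets X Y Z g f = compose X g f"
  by (simp add: Sets_def)

lemmas Sets_simps = Obj_Sets Hom_Sets Ident_Sets Comp_Sets

lemma category_Sets: "category Sets"
  by standard
    (auto simp: Sets_simps PiE_iff compose_def restrict_eq_restrict_iff restrict_eq_extensional_iff)

lemma Obj_Grp: "G \<in> Obj Grp \<longleftrightarrow> group G \<and> small (carrier G)"
  by (simp add: Grp_def)

lemma Hom_Grp: "f \<in> Hom Grp G H \<longleftrightarrow>
    G \<in> Obj Grp \<and> H \<in> Obj Grp \<and> f \<in> hom G H \<and> f \<in> extensional (carrier G)"
  by (auto simp: Grp_def)

lemma Ident_Grp: "Ident Grp G = (\<lambda>x\<in>carrier G. x)"
  by (simp add: Grp_def)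

lemma Comp_Grp: "Comp Grp G H J g f = compose (carrier G) g f"
  by (simp add: Grp_def)

lemmas Grp_simps = Hom_Grp Ident_Grp Comp_Grp

lemma category_Grp: "category Grp"
proof
  fix f :: "'a \<Rightarrow> 'a" and G H assume f: "f \<in> Hom Grp G H"
  then have fc: "\<And>x. x \<in> carrier G \<Longrightarrow> f x \<in> carrier H"
    by (auto simp: Grp_simps hom_def)
  show "G \<in> Obj Grp \<and> H \<in> Obj Grp"
    using f by (simp add: Hom_Grp)
  show "Comp Grp G H H (Ident Grp H) f = f" "Comp Grp G G H f (Ident Grp G) = f"
    using f fc by (auto simp: Grp_simps compose_def restrict_eq_extensional_iff)
  fix g J assume g: "g \<in> Hom Grp H J"
  have "compose (carrier G) g f \<in> hom G J"
    using f g by (auto simp: Grp_simps Obj_Grp group.hom_compose)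
  then show "Comp Grp G H J g f \<in> Hom Grp G J"
    using f g by (simp add: Grp_simps)
  show "Comp Grp G H L (Comp Grp H J L h g) f = Comp Grp G J L h (Comp Grp G H J g f)" for h L
    using fc by (auto simp: Grp_simps compose_def restrict_eq_restrict_iff)
next
  fix G :: "'a monoid" assume G: "G \<in> Obj Grp"
  \<comment> \<open>Closure under the product lets the restricted identity be evaluated at
    \<open>x \<otimes> y\<close>.\<close>
  then interpret group G by (simp add: Obj_Grp)
  show "Ident Grp G \<in> Hom Grp G G"
    using G by (auto simp: Grp_simps hom_def)
qed

section \<open>The comonad of a group\<close>

lemma app_in_expo: "\<phi> \<in> expo A X \<Longrightarrow> small A \<Longrightarrow> a \<in> A \<Longrightarrow> app \<phi> a \<in> X"
  by (auto simp: expo_def app_graph)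

text \<open>The eta rule for represented functions; \<open>app_graph\<close> is the beta
  rule.\<close>

lemma graph_app: "small A \<Longrightarrow> \<phi> \<in> expo A X \<Longrightarrow> graph A (app \<phi>) = \<phi>"
  by (auto simp: expo_def graph_inject app_graph)

lemma graph_in_expo:
  assumes "small A" "\<And>a. a \<in> A \<Longrightarrow> f a \<in> X"
  shows "graph A f \<in> expo A X"
proof -
  \<comment> \<open>\<open>expo\<close> collects the graphs of extensional functions only, so
    \<open>f\<close> is first cut down to \<open>A\<close>, which leaves its graph
    unchanged.\<close>
  have "graph A f = graph A (restrict f A)"
    by (simp add: assms(1) graph_inject)
  then show ?thesis
    using assms(2) by (auto simp: expo_def)
qed

text \<open>Extensionality against an element of \<open>expo\<close> that is not written as a graph,
  as occurs in every identity and counit law below.\<close>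

lemma graph_eqI:
  "small A \<Longrightarrow> \<phi> \<in> expo A X \<Longrightarrow> (\<And>a. a \<in> A \<Longrightarrow> f a = app \<phi> a) \<Longrightarrow> graph A f = \<phi>"
  by (metis graph_app graph_inject)

lemmas expo_simps = app_graph graph_inject graph_in_expo app_in_expo graph_app small_expo

lemmas ext_simps = compose_def restrict_eq_restrict_iff restrict_eq_extensional_iff

section \<open>The functor and the comonad attached to a group\<close>

lemma FObj_K_functor: "small X \<Longrightarrow> FObj (K_functor G) X = expo (carrier G) X"
  by (simp add: K_functor_def FObj_mk_functor Obj_Sets)

lemma FMor_K_functor:
  "small X \<Longrightarrow> small Y \<Longrightarrow> f \<in> X \<rightarrow>\<^sub>E Y \<Longrightarrow> FMor (K_functor G) X Y f
    = (\<lambda>\<phi>\<in>expo (carrier G) X. graph (carrier G) (\<lambda>g. f (app \<phi> g)))"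
  by (simp add: K_functor_def FMor_mk_functor Hom_Sets)

lemma is_functor_K_functor:
  assumes "small (carrier G)"
  shows "is_functor Sets Sets (K_functor G)"
  unfolding K_functor_def
  by (rule is_functor_mk_functor)
    (auto simp: category_Sets Sets_simps assms expo_simps ext_simps PiE_iff intro!: graph_eqI)

text \<open>The comonad laws are the monoid laws of \<open>G\<close> evaluated under
  \<open>\<phi>\<close>. The left counit law compares \<open>\<phi>(e h)\<close> with
  \<open>\<phi>(h)\<close>, the right one \<open>\<phi>(g e)\<close> with \<open>\<phi>(g)\<close>,
  and coassociativity \<open>\<phi>((g h) k)\<close> with \<open>\<phi>(g (h k))\<close>.\<close>

lemma comonad_K_comonad:
  assumes "G \<in> Obj Grp"
  shows "comonad Sets (K_comonad G)"
proof -
  interpret group G using assms by (simp add: Obj_Grp)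
  have sm: "small (carrier G)" using assms by (simp add: Obj_Grp)
  note simps = Sets_simps FObj_K_functor FMor_K_functor K_comonad_def sm expo_simps ext_simps
    id_functor_def comp_functor_def FObj_mk_functor FMor_mk_functor PiE_iff
  show ?thesis
  proof (intro comonad.intro comonad_axioms.intro)
    show "is_functor Sets Sets (Fun (K_comonad G))"
      by (simp add: K_comonad_def is_functor_K_functor sm)
    show "Counit (K_comonad G) \<in> nat_trans Sets Sets (Fun (K_comonad G)) (id_functor Sets)"
      by (rule nat_transI) (auto simp: simps)
    show "Comult (K_comonad G) \<in> nat_trans Sets Sets (Fun (K_comonad G))
        (comp_functor Sets (Fun (K_comonad G)) (Fun (K_comonad G)))"
      by (rule nat_transI) (auto simp: simps)
  qed (auto simp: simps m_assoc intro!: graph_eqI)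
qed

section \<open>Functoriality\<close>

text \<open>The arrow part of \<open>Phi\<close> before restriction to hom-sets. \<open>H\<close>
  comes first because a group morphism from \<open>G\<close> to \<open>H\<close> is an arrow from
  \<open>H\<close> to \<open>G\<close> in the opposite category.\<close>

definition Phi_map ::
  "'u::universe monoid \<Rightarrow> 'u monoid \<Rightarrow> ('u \<Rightarrow> 'u) \<Rightarrow> 'u set \<Rightarrow> 'u \<Rightarrow> 'u" where
  "Phi_map H G f = (\<lambda>X\<in>Obj Sets. \<lambda>\<alpha>\<in>expo (carrier H) X. graph (carrier G) (\<lambda>g. app \<alpha> (f g)))"

lemma Phi_map_comonad_morphism:
  assumes f: "f \<in> Hom Grp G H"
  shows "Phi_map H G f \<in> comonad_morphisms Sets (K_comonad H) (K_comonad G)"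
proof -
  have G: "G \<in> Obj Grp" and H: "H \<in> Obj Grp"
    using f by (simp_all add: Hom_Grp)
  interpret G: group G using G by (simp add: Obj_Grp)
  interpret H: group H using H by (simp add: Obj_Grp)
  have sm: "small (carrier G)" "small (carrier H)"
    using G H by (simp_all add: Obj_Grp)
  interpret f: group_hom G H f
    using f by unfold_locales (simp add: Hom_Grp)
  note simps = Sets_simps FObj_K_functor FMor_K_functor K_comonad_def sm expo_simps ext_simps
    PiE_iff Phi_map_def
  have "Phi_map H G f \<in> nat_trans Sets Sets (Fun (K_comonad H)) (Fun (K_comonad G))"
    by (rule nat_transI) (auto simp: simps)
  then show ?thesis
    unfolding comonad_morphisms_iff
    \<comment> \<open>At \<open>\<alpha>\<close> the counit equation compares
      \<open>\<alpha>(f e)\<close> with \<open>\<alpha>(e)\<close>, and the comultiplication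
      equation compares \<open>\<alpha>(f (g h))\<close> with
      \<open>\<alpha>(f g f h)\<close>.\<close>
    by (simp add: comonad_K_comonad G H) (auto simp: simps)
qed

lemma Phi_eq: "Phi = mk_functor (op_cat Grp) K_comonad Phi_map"
  unfolding Phi_def Phi_map_def ..

lemma is_functor_Phi: "is_functor (op_cat Grp) (Comonads Sets) Phi"
  unfolding Phi_eq
proof (rule is_functor_mk_functor)
  show "category (op_cat Grp)"
    by (rule category_op_cat[OF category_Grp])
  show "category (Comonads Sets)"
    by (rule category_Comonads[OF category_Sets])
  show "K_comonad G \<in> Obj (Comonads Sets)" if "G \<in> Obj (op_cat Grp)" for G :: "'a monoid"
    using that by (simp add: Comonads_def op_cat_def comonad_K_comonad)
  show "Phi_map H G f \<in> Hom (Comonads Sets) (K_comonad H) (K_comonad G)"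
    if "f \<in> Hom (op_cat Grp) H G" for f :: "'a \<Rightarrow> 'a" and G H
    using that by (simp add: Comonads_def op_cat_def Phi_map_comonad_morphism)
  \<comment> \<open>The identity of \<open>G\<close> sends \<open>\<alpha>\<close> to the graph of
    its own evaluation, which is \<open>\<alpha>\<close> again by \<open>graph_eqI\<close>.\<close>
  show "Phi_map G G (Ident (op_cat Grp) G) = Ident (Comonads Sets) (K_comonad G)"
    if "G \<in> Obj (op_cat Grp)" for G :: "'a monoid"
    using that
    by (auto simp: Comonads_def op_cat_def Obj_Grp Ident_Grp Phi_map_def id_trans_def Sets_simps
        K_comonad_def FObj_K_functor restrict_eq_restrict_iff intro!: graph_eqI)
  \<comment> \<open>In the opposite category \<open>f\<close> after \<open>g\<close> is the group
    morphism sending \<open>x\<close> to \<open>g (f x)\<close>, so both sides take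
    \<open>\<alpha>\<close> to the graph of \<open>\<alpha>(g (f x))\<close>.\<close>
  show "Phi_map J G (Comp (op_cat Grp) J H G f g)
      = Comp (Comonads Sets) (K_comonad J) (K_comonad H) (K_comonad G)
          (Phi_map H G f) (Phi_map J H g)"
    if "g \<in> Hom (op_cat Grp) J H" "f \<in> Hom (op_cat Grp) H G"
    for f g :: "'a \<Rightarrow> 'a" and G H J
  proof -
    have "f \<in> carrier G \<rightarrow> carrier H" "g \<in> carrier H \<rightarrow> carrier J"
      and "small (carrier G)" "small (carrier H)" "small (carrier J)"
      using that by (auto simp: op_cat_def Hom_Grp Obj_Grp hom_def)
    then show ?thesis
      by (auto simp: Comonads_def op_cat_def Comp_Grp Phi_map_def vcomp_def Sets_simps
          K_comonad_def FObj_K_functor expo_simps ext_simps Pi_iff)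
  qed
qed

text \<open>Every element of \<open>expo (carrier H) X\<close> is the graph of some extensional
  \<open>\<alpha>\<close>, so the last clause determines each component of \<open>Phi f\<close>
  completely. The composite \<open>\<alpha> \<circ> f\<close> can stand unrestricted because
  \<open>graph\<close> reads it on \<open>carrier G\<close> alone.\<close>

theorem proposition22:
  shows "is_functor (op_cat Grp) (Comonads Sets)
           (Phi :: ('u::universe monoid, 'u \<Rightarrow> 'u,
                    ('u set, 'u \<Rightarrow> 'u) cmnd, 'u set \<Rightarrow> 'u \<Rightarrow> 'u) fctr)
    \<and> (\<forall>G \<in> Obj (Grp :: ('u monoid, 'u \<Rightarrow> 'u) cat). FObj Phi G = K_comonad G)
    \<and> (\<forall>(G :: 'u monoid) H. \<forall>f \<in> Hom Grp G H.
         FMor Phi H G f \<in> Hom (Comonads Sets) (K_comonad H) (K_comonad G)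
         \<and> (\<forall>X \<in> Obj Sets. \<forall>\<alpha> \<in> carrier H \<rightarrow>\<^sub>E X.
              FMor Phi H G f X (graph (carrier H) \<alpha>) = graph (carrier G) (\<alpha> \<circ> f)))"
proof (intro conjI allI ballI)
  show "is_functor (op_cat Grp) (Comonads Sets)
      (Phi :: ('u monoid, 'u \<Rightarrow> 'u, ('u set, 'u \<Rightarrow> 'u) cmnd, 'u set \<Rightarrow> 'u \<Rightarrow> 'u) fctr)"
    by (rule is_functor_Phi)
  show "FObj Phi G = K_comonad G" if "G \<in> Obj Grp" for G :: "'u monoid"
    using that by (simp add: Phi_eq FObj_mk_functor op_cat_def)
  fix G H :: "'u monoid" and f assume f: "f \<in> Hom Grp G H"
  then have eq: "FMor Phi H G f = Phi_map H G f"
    by (simp add: Phi_eq FMor_mk_functor op_cat_def)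
  show "FMor Phi H G f \<in> Hom (Comonads Sets) (K_comonad H) (K_comonad G)"
    using f by (simp add: eq Comonads_def Phi_map_comonad_morphism)
  fix X \<alpha> assume "X \<in> Obj (Sets :: ('u set, 'u \<Rightarrow> 'u) cat)" "\<alpha> \<in> carrier H \<rightarrow>\<^sub>E X"
  moreover have "f \<in> carrier G \<rightarrow> carrier H" "small (carrier G)" "small (carrier H)"
    using f by (auto simp: Hom_Grp Obj_Grp hom_def)
  ultimately show "FMor Phi H G f X (graph (carrier H) \<alpha>) = graph (carrier G) (\<alpha> \<circ> f)"
    by (auto simp: eq Phi_map_def Obj_Sets expo_def expo_simps Pi_iff)
qed

end
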